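(* Let $p:\mathbb E\to\mathbb B$ be a posetal fibration with fibred small limits and $\mathcal T$ a monad on $\mathbb B$. For any $X\in\mathbb E$: $q_X\circ[-]^{pX}=\mathrm{id}_{\mathbf{Cls}(\mathcal T,X)}$, and for every $\dot{\mathcal T}\in\mathbf{Lift}(\mathcal T)$ we have $\dot T\preceq[\dot TX]^{pX}$ (i.e. $\mathrm{id}_{\mathbf{Lift}(\mathcal T)}\preceq[-]^{pX}\circ q_X$).
   Context: $p$ posetal: fibres are posets; $p$ faithful, and $\mathbb E(X,Y)\subseteq\mathbb B(pX,pY)$. Fibres have arbitrary meets $\bigwedge$. $\mathcal T=(T,\eta,\mu)$, $f^\#=\mu\circ Tf$. $\mathbf{Lift}(\mathcal T)$ is the class of liftings of $\mathcal T$ along $p$ (monads $\dot{\mathcal T}$ on $\mathbb E$ with $p\dot T=Tp$, $p\dot\eta=\eta p$, $p\dot\mu=\mu p$), ordered by $\dot T\preceq\dot T'$ iff $\dot TX\le\dot T'X$ in $\mathbb E_{T(pX)}$ for all $X$. For $R\in\mathbb B$, $S\in\mathbb E_{TR}$, $[S]^R\in\mathbf{Lift}(\mathcal T)$ is the (pointwise) codensity lifting with single parameter $(R,S)$, with object part $[S]^RY=\bigwedge_{f\in\mathbb E(Y,S)}(f^\#)^{-1}(S)$. $\mathbf{Cls}(\mathcal T,X)=\{S\in\mathbb E_{T(pX)}\mid S=[S]^{pX}X\}$ with order inherited from the fibre; $[-]^{pX}$ is regarded as a function $\mathbf{Cls}(\mathcal T,X)\to\mathbf{Lift}(\mathcal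 T)$; $q_X:\mathbf{Lift}(\mathcal T)\to\mathbf{Cls}(\mathcal T,X)$, $q_X(\dot T)=\dot TX$. *)

theory Defs
  imports "HOL-Algebra.Lattice"
begin

section \<open>Categories, functors, natural transformations, monads\<close>

record ('o, 'a) cat =
  Obj :: "'o set"
  Arr :: "'a set"
  Dom :: "'a \<Rightarrow> 'o"
  Cod :: "'a \<Rightarrow> 'o"
  Ident :: "'o \<Rightarrow> 'a"
  Comp :: "'a \<Rightarrow> 'a \<Rightarrow> 'a"  (infixl "\<cdot>\<index>" 70)

definition Hom :: "('o, 'a) cat \<Rightarrow> 'o \<Rightarrow> 'o \<Rightarrow> 'a set" where
  "Hom C X Y = {f \<in> Arr C. Dom C f = X \<and> Cod C f = Y}"

locale category =
  fixes C :: "('o, 'a) cat" (structure)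
  assumes Dom_in_Obj: "f \<in> Arr C \<Longrightarrow> Dom C f \<in> Obj C"
    and Cod_in_Obj: "f \<in> Arr C \<Longrightarrow> Cod C f \<in> Obj C"
    and Ident_in_Hom: "X \<in> Obj C \<Longrightarrow> Ident C X \<in> Hom C X X"
    and Comp_in_Hom: "f \<in> Hom C X Y \<Longrightarrow> g \<in> Hom C Y Z \<Longrightarrow> g \<cdot> f \<in> Hom C X Z"
    and Ident_left: "f \<in> Hom C X Y \<Longrightarrow> Ident C Y \<cdot> f = f"
    and Ident_right: "f \<in> Hom C X Y \<Longrightarrow> f \<cdot> Ident C X = f"
    and Comp_assoc: "f \<in> Hom C W X \<Longrightarrow> g \<in> Hom C X Y \<Longrightarrow> h \<in> Hom C Y Z \<Longrightarrow>
          (h \<cdot> g) \<cdot> f = h \<cdot> (g \<cdot> f)"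

record ('o1, 'a1, 'o2, 'a2) fctr =
  omap :: "'o1 \<Rightarrow> 'o2"
  amap :: "'a1 \<Rightarrow> 'a2"

locale cat_functor = C: category C + D: category D
  for C :: "('o1, 'a1) cat" and D :: "('o2, 'a2) cat" +
  fixes F :: "('o1, 'a1, 'o2, 'a2) fctr"
  assumes omap_in_Obj: "X \<in> Obj C \<Longrightarrow> omap F X \<in> Obj D"
    and amap_in_Hom: "f \<in> Hom C X Y \<Longrightarrow> amap F f \<in> Hom D (omap F X) (omap F Y)"
    and amap_Ident: "X \<in> Obj C \<Longrightarrow> amap F (Ident C X) = Ident D (omap F X)"
    and amap_Comp: "f \<in> Hom C X Y \<Longrightarrow> g \<in> Hom C Y Z \<Longrightarrow>
          amap F (g \<cdot>\<^bsub>C\<^esub> f) = amap F g \<cdot>\<^bsub>D\<^esub> amap F f"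

definition id_fctr :: "('o, 'a, 'o, 'a) fctr" where
  "id_fctr = \<lparr>omap = (\<lambda>X. X), amap = (\<lambda>f. f)\<rparr>"

definition comp_fctr ::
  "('o2, 'a2, 'o3, 'a3) fctr \<Rightarrow> ('o1, 'a1, 'o2, 'a2) fctr \<Rightarrow> ('o1, 'a1, 'o3, 'a3) fctr" where
  "comp_fctr G F = \<lparr>omap = omap G \<circ> omap F, amap = amap G \<circ> amap F\<rparr>"

locale nat_trans = F: cat_functor C D F + G: cat_functor C D G
  for C :: "('o1, 'a1) cat" and D :: "('o2, 'a2) cat"
    and F :: "('o1, 'a1, 'o2, 'a2) fctr" and G :: "('o1, 'a1, 'o2, 'a2) fctr" +
  fixes \<alpha> :: "'o1 \<Rightarrow> 'a2"
  assumes component_in_Hom: "X \<in> Obj C \<Longrightarrow> \<alpha> X \<in> Hom D (omap F X) (omap G X)"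
    and naturality: "f \<in> Hom C X Y \<Longrightarrow> \<alpha> Y \<cdot>\<^bsub>D\<^esub> amap F f = amap G f \<cdot>\<^bsub>D\<^esub> \<alpha> X"

record ('o, 'a) monad_data =
  mfun :: "('o, 'a, 'o, 'a) fctr"
  munit :: "'o \<Rightarrow> 'a"
  mmult :: "'o \<Rightarrow> 'a"

abbreviation mobj :: "('o, 'a) monad_data \<Rightarrow> 'o \<Rightarrow> 'o" where
  "mobj T \<equiv> omap (mfun T)"

abbreviation marr :: "('o, 'a) monad_data \<Rightarrow> 'a \<Rightarrow> 'a" where
  "marr T \<equiv> amap (mfun T)"

locale cat_monad =
  unit: nat_trans C C id_fctr "mfun T" "munit T" +
  mult: nat_trans C C "comp_fctr (mfun T) (mfun T)" "mfun T" "mmult T"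
  for C :: "('o, 'a) cat" (structure) and T :: "('o, 'a) monad_data" +
  assumes mult_unit_left: "X \<in> Obj C \<Longrightarrow> mmult T X \<cdot> munit T (mobj T X) = Ident C (mobj T X)"
    and mult_unit_right: "X \<in> Obj C \<Longrightarrow> mmult T X \<cdot> marr T (munit T X) = Ident C (mobj T X)"
    and mult_assoc: "X \<in> Obj C \<Longrightarrow>
          mmult T X \<cdot> mmult T (mobj T X) = mmult T X \<cdot> marr T (mmult T X)"

text \<open>Kleisli extension \<open>f\<^sup>#\<close> of an arrow \<open>f : Y \<rightarrow> T R\<close>; the object \<open>R\<close> is not determined by
  \<open>f\<close> and is passed explicitly.\<close>

definition kleisli_ext :: "('o, 'a) cat \<Rightarrow> ('o, 'a) monad_data \<Rightarrow> 'o \<Rightarrow> 'a \<Rightarrow> 'a" where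
  "kleisli_ext C T R f = mmult T R \<cdot>\<^bsub>C\<^esub> marr T f"


section \<open>Posetal fibrations with fibred small limits\<close>

definition cartesian_arrow ::
  "('eo, 'ea) cat \<Rightarrow> ('bo, 'ba) cat \<Rightarrow> ('eo, 'ea, 'bo, 'ba) fctr \<Rightarrow> 'ea \<Rightarrow> bool" where
  "cartesian_arrow E B p a \<longleftrightarrow> a \<in> Arr E \<and>
     (\<forall>b \<in> Arr E. \<forall>w \<in> Hom B (omap p (Dom E b)) (omap p (Dom E a)).
        Cod E b = Cod E a \<and> amap p b = amap p a \<cdot>\<^bsub>B\<^esub> w \<longrightarrow>
        (\<exists>!c. c \<in> Hom E (Dom E b) (Dom E a) \<and> amap p c = w \<and> a \<cdot>\<^bsub>E\<^esub> c = b))"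

locale fibration = cat_functor E B p
  for E :: "('eo, 'ea) cat" and B :: "('bo, 'ba) cat" and p :: "('eo, 'ea, 'bo, 'ba) fctr" +
  assumes cartesian_lift: "Y \<in> Obj E \<Longrightarrow> u \<in> Hom B I (omap p Y) \<Longrightarrow>
      \<exists>a. cartesian_arrow E B p a \<and> Cod E a = Y \<and> amap p a = u"

definition vertical ::
  "('eo, 'ea) cat \<Rightarrow> ('bo, 'ba) cat \<Rightarrow> ('eo, 'ea, 'bo, 'ba) fctr \<Rightarrow> 'bo \<Rightarrow> 'eo \<Rightarrow> 'eo \<Rightarrow> 'ea set" where
  "vertical E B p I X Y = {a \<in> Hom E X Y. amap p a = Ident B I}"

definition fibre ::
  "('eo, 'ea) cat \<Rightarrow> ('bo, 'ba) cat \<Rightarrow> ('eo, 'ea, 'bo, 'ba) fctr \<Rightarrow> 'bo \<Rightarrow> 'eo gorder" where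
  "fibre E B p I = \<lparr>carrier = {X \<in> Obj E. omap p X = I}, eq = (=),
     le = (\<lambda>X Y. vertical E B p I X Y \<noteq> {})\<rparr>"

text \<open>The fibre categories are posets: there is at most one vertical arrow between two objects, and
  the induced preorder is antisymmetric. Faithfulness of \<open>p\<close> is a consequence, see below.\<close>

locale posetal_fibration = fibration E B p
  for E :: "('eo, 'ea) cat" and B :: "('bo, 'ba) cat" and p :: "('eo, 'ea, 'bo, 'ba) fctr" +
  assumes fibre_thin: "I \<in> Obj B \<Longrightarrow> X \<in> carrier (fibre E B p I) \<Longrightarrow> Y \<in> carrier (fibre E B p I) \<Longrightarrow>
      a \<in> vertical E B p I X Y \<Longrightarrow> b \<in> vertical E B p I X Y \<Longrightarrow> a = b"
    and fibre_partial_order: "I \<in> Obj B \<Longrightarrow> partial_order (fibre E B p I)"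

text \<open>The reindexing \<open>u\<^sup>-\<^sup>1 Y\<close>, the domain of a Cartesian arrow over \<open>u\<close> into \<open>Y\<close>.\<close>

definition reindex ::
  "('eo, 'ea) cat \<Rightarrow> ('bo, 'ba) cat \<Rightarrow> ('eo, 'ea, 'bo, 'ba) fctr \<Rightarrow> 'ba \<Rightarrow> 'eo \<Rightarrow> 'eo" where
  "reindex E B p u Y =
     (THE X. \<exists>a \<in> Hom E X Y. cartesian_arrow E B p a \<and> amap p a = u)"

text \<open>In a poset, small limits are meets of sets of elements; ``fibred'' means that reindexing
  preserves them. The empty meet, i.e. the top element of a fibre, is included.\<close>

locale posetal_fibration_with_meets = posetal_fibration E B p
  for E :: "('eo, 'ea) cat" and B :: "('bo, 'ba) cat" and p :: "('eo, 'ea, 'bo, 'ba) fctr" +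
  assumes fibre_meet: "I \<in> Obj B \<Longrightarrow> A \<subseteq> carrier (fibre E B p I) \<Longrightarrow>
      \<exists>Y. is_glb (fibre E B p I) Y A"
    and reindex_meet: "u \<in> Hom B I J \<Longrightarrow> A \<subseteq> carrier (fibre E B p J) \<Longrightarrow>
      is_glb (fibre E B p J) Y A \<Longrightarrow>
      is_glb (fibre E B p I) (reindex E B p u Y) (reindex E B p u ` A)"

lemma (in posetal_fibration) p_faithful:
  assumes X: "X \<in> Obj E" and Y: "Y \<in> Obj E"
  shows "inj_on (amap p) (Hom E X Y)"
proof (rule inj_onI)
  fix f g assume f: "f \<in> Hom E X Y" and g: "g \<in> Hom E X Y" and eq: "amap p f = amap p g"
  have u: "amap p f \<in> Hom B (omap p X) (omap p Y)" by (rule amap_in_Hom[OF f])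
  obtain a where a: "cartesian_arrow E B p a" "Cod E a = Y" "amap p a = amap p f"
    using cartesian_lift[OF Y u] by blast
  have aA: "a \<in> Arr E" using a(1) by (simp add: cartesian_arrow_def)
  have pa: "amap p a \<in> Hom B (omap p (Dom E a)) (omap p Y)"
    using aA a(2) by (intro amap_in_Hom) (simp add: Hom_def)
  have dom: "omap p (Dom E a) = omap p X" using pa u a(3) by (simp add: Hom_def)
  have IX: "Ident B (omap p X) \<in> Hom B (omap p X) (omap p (Dom E a))"
    unfolding dom by (rule D.Ident_in_Hom[OF omap_in_Obj[OF X]])
  have fac: "\<exists>c. c \<in> vertical E B p (omap p X) X (Dom E a) \<and> a \<cdot>\<^bsub>E\<^esub> c = h"
    if h: "h \<in> Hom E X Y" and ph: "amap p h = amap p f" for h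
  proof -
    have "h \<in> Arr E" "Dom E h = X" "Cod E h = Cod E a" using h a(2) by (auto simp: Hom_def)
    moreover have "amap p h = amap p a \<cdot>\<^bsub>B\<^esub> Ident B (omap p X)"
      using ph a(3) D.Ident_right[OF u] by simp
    ultimately have "\<exists>!c. c \<in> Hom E X (Dom E a) \<and> amap p c = Ident B (omap p X) \<and> a \<cdot>\<^bsub>E\<^esub> c = h"
      using a(1) IX unfolding cartesian_arrow_def by metis
    then show ?thesis unfolding vertical_def by auto
  qed
  obtain c where c: "c \<in> vertical E B p (omap p X) X (Dom E a)" "a \<cdot>\<^bsub>E\<^esub> c = f"
    using fac[OF f] by auto
  obtain d where d: "d \<in> vertical E B p (omap p X) X (Dom E a)" "a \<cdot>\<^bsub>E\<^esub> d = g"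
    using fac[OF g] eq by auto
  have "c = d"
    by (rule fibre_thin[OF omap_in_Obj[OF X] _ _ c(1) d(1)])
       (use X dom C.Dom_in_Obj[OF aA] in \<open>simp_all add: fibre_def\<close>)
  then show "f = g" using c(2) d(2) by simp
qed

lemma (in posetal_fibration) reindex_cartesian:
  assumes Y: "Y \<in> Obj E" and u: "u \<in> Hom B I (omap p Y)"
  shows "\<exists>a \<in> Hom E (reindex E B p u Y) Y. cartesian_arrow E B p a \<and> amap p a = u"
  unfolding reindex_def
proof (rule theI')
  let ?P = "\<lambda>X. \<exists>a \<in> Hom E X Y. cartesian_arrow E B p a \<and> amap p a = u"
  have over: "X \<in> Obj E \<and> omap p X = I" if P: "?P X" for X
  proof -
    obtain a where a: "a \<in> Hom E X Y" "amap p a = u" using P by blast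
    then show ?thesis using C.Dom_in_Obj amap_in_Hom[OF a(1)] u by (auto simp: Hom_def)
  qed
  have le: "vertical E B p I X X' \<noteq> {}" if P: "?P X" and P': "?P X'" for X X'
  proof -
    obtain a where a: "a \<in> Hom E X Y" "amap p a = u" using P by blast
    obtain b where b: "b \<in> Hom E X' Y" "cartesian_arrow E B p b" "amap p b = u" using P' by blast
    have I: "I \<in> Obj B" using over[OF P] omap_in_Obj by blast
    have "Ident B I \<in> Hom B (omap p (Dom E a)) (omap p (Dom E b))"
      using over[OF P] over[OF P'] D.Ident_in_Hom[OF I] a(1) b(1) by (simp add: Hom_def)
    moreover have "amap p a = amap p b \<cdot>\<^bsub>B\<^esub> Ident B I" using a b D.Ident_right[OF u] by simp
    ultimately have "\<exists>!c. c \<in> Hom E (Dom E a) (Dom E b) \<and> amap p c = Ident B I \<and> b \<cdot>\<^bsub>E\<^esub> c = a"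
    proof -
      have "a \<in> Arr E" "Cod E a = Cod E b" using a(1) b(1) by (auto simp: Hom_def)
      with b(2) \<open>Ident B I \<in> _\<close> \<open>amap p a = amap p b \<cdot>\<^bsub>B\<^esub> Ident B I\<close> show ?thesis
        unfolding cartesian_arrow_def by blast
    qed
    then show ?thesis using a(1) b(1) by (auto simp: vertical_def Hom_def)
  qed
  obtain a where a: "cartesian_arrow E B p a" "Cod E a = Y" "amap p a = u"
    using cartesian_lift[OF Y u] by blast
  show "\<exists>!X. ?P X"
  proof (rule ex1I)
    show "?P (Dom E a)" using a by (auto simp: cartesian_arrow_def Hom_def)
    fix X assume X: "?P X"
    have a': "?P (Dom E a)" using a by (auto simp: cartesian_arrow_def Hom_def)
    have I: "I \<in> Obj B" using over[OF X] omap_in_Obj by blast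
    interpret po: partial_order "fibre E B p I" by (rule fibre_partial_order[OF I])
    show "X = Dom E a"
      using po.le_antisym[of X "Dom E a"] over[OF X] over[OF a'] le[OF X a'] le[OF a' X]
      by (simp add: fibre_def)
  qed
qed


section \<open>Liftings of monads and codensity liftings\<close>

definition Lift ::
  "('eo, 'ea) cat \<Rightarrow> ('bo, 'ba) cat \<Rightarrow> ('eo, 'ea, 'bo, 'ba) fctr \<Rightarrow> ('bo, 'ba) monad_data \<Rightarrow>
   ('eo, 'ea) monad_data set" where
  "Lift E B p T = {T'. cat_monad E T' \<and>
     (\<forall>X \<in> Obj E. omap p (mobj T' X) = mobj T (omap p X)) \<and>
     (\<forall>f \<in> Arr E. amap p (marr T' f) = marr T (amap p f)) \<and>
     (\<forall>X \<in> Obj E. amap p (munit T' X) = munit T (omap p X)) \<and>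
     (\<forall>X \<in> Obj E. amap p (mmult T' X) = mmult T (omap p X))}"

definition lift_le ::
  "('eo, 'ea) cat \<Rightarrow> ('bo, 'ba) cat \<Rightarrow> ('eo, 'ea, 'bo, 'ba) fctr \<Rightarrow> ('bo, 'ba) monad_data \<Rightarrow>
   ('eo, 'ea) monad_data \<Rightarrow> ('eo, 'ea) monad_data \<Rightarrow> bool" where
  "lift_le E B p T T1 T2 \<longleftrightarrow>
     (\<forall>X \<in> Obj E. mobj T1 X \<sqsubseteq>\<^bsub>fibre E B p (mobj T (omap p X))\<^esub> mobj T2 X)"

text \<open>By faithfulness an arrow \<open>X \<rightarrow> Y\<close> of \<open>E\<close> is determined by its image under \<open>p\<close>; this is the
  arrow \<open>X \<rightarrow> Y\<close> over \<open>u\<close>, if there is one.\<close>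

definition arrow_over ::
  "('eo, 'ea) cat \<Rightarrow> ('eo, 'ea, 'bo, 'ba) fctr \<Rightarrow> 'eo \<Rightarrow> 'eo \<Rightarrow> 'ba \<Rightarrow> 'ea" where
  "arrow_over E p X Y u = (THE a. a \<in> Hom E X Y \<and> amap p a = u)"

definition codensity_obj ::
  "('eo, 'ea) cat \<Rightarrow> ('bo, 'ba) cat \<Rightarrow> ('eo, 'ea, 'bo, 'ba) fctr \<Rightarrow> ('bo, 'ba) monad_data \<Rightarrow>
   'bo \<Rightarrow> 'eo \<Rightarrow> 'eo \<Rightarrow> 'eo" where
  "codensity_obj E B p T R S Y =
     \<Sqinter>\<^bsub>fibre E B p (mobj T (omap p Y))\<^esub>
       ((\<lambda>f. reindex E B p (kleisli_ext B T R (amap p f)) S) ` Hom E Y S)"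

definition codensity ::
  "('eo, 'ea) cat \<Rightarrow> ('bo, 'ba) cat \<Rightarrow> ('eo, 'ea, 'bo, 'ba) fctr \<Rightarrow> ('bo, 'ba) monad_data \<Rightarrow>
   'bo \<Rightarrow> 'eo \<Rightarrow> ('eo, 'ea) monad_data" where
  "codensity E B p T R S = (let K = codensity_obj E B p T R S in
     \<lparr>mfun = \<lparr>omap = K,
              amap = (\<lambda>f. arrow_over E p (K (Dom E f)) (K (Cod E f)) (marr T (amap p f)))\<rparr>,
      munit = (\<lambda>Y. arrow_over E p Y (K Y) (munit T (omap p Y))),
      mmult = (\<lambda>Y. arrow_over E p (K (K Y)) (K Y) (mmult T (omap p Y)))\<rparr>)"

definition Cls ::
  "('eo, 'ea) cat \<Rightarrow> ('bo, 'ba) cat \<Rightarrow> ('eo, 'ea, 'bo, 'ba) fctr \<Rightarrow> ('bo, 'ba) monad_data \<Rightarrow>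
   'eo \<Rightarrow> 'eo set" where
  "Cls E B p T X = {S \<in> carrier (fibre E B p (mobj T (omap p X))).
     S = mobj (codensity E B p T (omap p X) S) X}"

definition q_map :: "'eo \<Rightarrow> ('eo, 'ea) monad_data \<Rightarrow> 'eo" where
  "q_map X T' = mobj T' X"

end

theory Submission
  imports Defs
begin

text \<open>Since \<open>p\<close> is faithful, an arrow of \<open>E\<close> is a property of an arrow of \<open>B\<close>, so all monad
  equations in \<open>E\<close> are inherited from \<open>T\<close> and only the existence of arrows over prescribed arrows
  matters. Because reindexing preserves meets, an arrow \<open>w\<close> of \<open>B\<close> lifts to \<open>W \<rightarrow> [S]\<^sup>R Y\<close> iff
  \<open>f\<^sup># \<circ> w\<close> lifts to \<open>W \<rightarrow> S\<close> for all \<open>f : Y \<rightarrow> S\<close>. The unit, the functorial action and the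
  multiplication of \<open>[S]\<^sup>R\<close> then come from \<open>f\<^sup># \<circ> \<eta> = f\<close>, \<open>f\<^sup># \<circ> T g = (f \<circ> g)\<^sup>#\<close> and
  \<open>f\<^sup># \<circ> \<mu> = (f\<^sup>#)\<^sup>#\<close>. For a lifting \<open>T'\<close> and \<open>f : Y \<rightarrow> T' X\<close>, the Kleisli extension of \<open>f\<close>
  for \<open>T'\<close> lies over \<open>f\<^sup>#\<close>, whence \<open>T' Y \<le> [T' X] Y\<close>; for \<open>Y = X\<close> the choice \<open>f = \<eta>\<close> gives
  equality.\<close>

section \<open>Arrows of the base that have an arrow above them\<close>

text \<open>Only existence is recorded: for the faithful \<open>p\<close> the arrow over
  \<open>u\<close> with given ends is unique, so nothing about arrows of \<open>E\<close> is
  lost.\<close>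

definition (in cat_functor) lifts_to :: "'o1 \<Rightarrow> 'o1 \<Rightarrow> 'a2 \<Rightarrow> bool" where
  "lifts_to X Y u \<longleftrightarrow> (\<exists>a \<in> Hom C X Y. amap F a = u)"

lemma (in category) Hom_in_Obj:
  assumes "f \<in> Hom C X Y"
  shows "X \<in> Obj C" "Y \<in> Obj C"
  using assms Dom_in_Obj Cod_in_Obj by (auto simp: Hom_def)

context cat_functor
begin

lemma lifts_toI: "a \<in> Hom C X Y \<Longrightarrow> amap F a = u \<Longrightarrow> lifts_to X Y u"
  by (auto simp: lifts_to_def)

lemma lifts_to_Ident: "X \<in> Obj C \<Longrightarrow> lifts_to X X (Ident D (omap F X))"
  by (rule lifts_toI[OF C.Ident_in_Hom amap_Ident])

lemma lifts_to_Comp: "lifts_to X Y u \<Longrightarrow> lifts_to Y Z v \<Longrightarrow> lifts_to X Z (v \<cdot>\<^bsub>D\<^esub> u)"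
  unfolding lifts_to_def using C.Comp_in_Hom amap_Comp by metis

lemma lifts_to_in_Hom: "lifts_to X Y u \<Longrightarrow> u \<in> Hom D (omap F X) (omap F Y)"
  unfolding lifts_to_def using amap_in_Hom by blast

lemma lifts_to_in_Obj:
  assumes "lifts_to X Y u"
  shows "X \<in> Obj C" "Y \<in> Obj C"
  using assms C.Hom_in_Obj unfolding lifts_to_def by blast+

end

section \<open>Order and reindexing in the fibres\<close>

lemma carrier_fibre_iff: "Y \<in> carrier (fibre E B p I) \<longleftrightarrow> Y \<in> Obj E \<and> omap p Y = I"
  by (simp add: fibre_def)

context posetal_fibration
begin

text \<open>Translates the fibre order into liftability, so that inequalities can be composed with
  arrows over arbitrary base arrows.\<close>

lemma fibre_le_iff: "X \<sqsubseteq>\<^bsub>fibre E B p I\<^esub> Y \<longleftrightarrow> lifts_to X Y (Ident B I)"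
  by (auto simp: fibre_def vertical_def lifts_to_def)

lemma arrow_eqI:
  "f \<in> Hom E X Y \<Longrightarrow> g \<in> Hom E X Y \<Longrightarrow> amap p f = amap p g \<Longrightarrow> f = g"
  using p_faithful C.Hom_in_Obj by (meson inj_onD)

lemma arrow_over:
  assumes "lifts_to X Y u"
  shows "arrow_over E p X Y u \<in> Hom E X Y" "amap p (arrow_over E p X Y u) = u"
proof -
  have "\<exists>!a. a \<in> Hom E X Y \<and> amap p a = u"
    using assms arrow_eqI unfolding lifts_to_def by blast
  then have "arrow_over E p X Y u \<in> Hom E X Y \<and> amap p (arrow_over E p X Y u) = u"
    unfolding arrow_over_def by (rule theI')
  then show "arrow_over E p X Y u \<in> Hom E X Y" "amap p (arrow_over E p X Y u) = u" by auto
qed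

lemma reindex_lifts_to:
  assumes "Y \<in> Obj E" "u \<in> Hom B I (omap p Y)"
  shows "lifts_to (reindex E B p u Y) Y u"
  using reindex_cartesian[OF assms] by (auto simp: lifts_to_def)

lemma reindex_in_fibre:
  assumes "Y \<in> Obj E" "u \<in> Hom B I (omap p Y)"
  shows "reindex E B p u Y \<in> carrier (fibre E B p I)"
  using reindex_lifts_to[OF assms] lifts_to_in_Obj lifts_to_in_Hom assms(2)
  by (fastforce simp: carrier_fibre_iff Hom_def)

text \<open>The universal property of the Cartesian arrow over \<open>u\<close>: composing with it
  gives one direction, factoring through it the other.\<close>

lemma lifts_to_reindex_iff:
  assumes Y: "Y \<in> Obj E" and u: "u \<in> Hom B I (omap p Y)"
    and w: "w \<in> Hom B (omap p W) I"
  shows "lifts_to W (reindex E B p u Y) w \<longleftrightarrow> lifts_to W Y (u \<cdot>\<^bsub>B\<^esub> w)"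
proof
  assume "lifts_to W (reindex E B p u Y) w"
  then show "lifts_to W Y (u \<cdot>\<^bsub>B\<^esub> w)" using lifts_to_Comp reindex_lifts_to[OF Y u] by blast
next
  assume "lifts_to W Y (u \<cdot>\<^bsub>B\<^esub> w)"
  then obtain b where b: "b \<in> Hom E W Y" "amap p b = u \<cdot>\<^bsub>B\<^esub> w" by (auto simp: lifts_to_def)
  obtain a where a: "a \<in> Hom E (reindex E B p u Y) Y" "cartesian_arrow E B p a" "amap p a = u"
    using reindex_cartesian[OF Y u] by blast
  have "omap p (reindex E B p u Y) = I"
    using reindex_in_fibre[OF Y u] by (simp add: carrier_fibre_iff)
  then have "w \<in> Hom B (omap p (Dom E b)) (omap p (Dom E a))"
    using a(1) b(1) w by (simp add: Hom_def)
  moreover have "b \<in> Arr E" "Cod E b = Cod E a" "amap p b = amap p a \<cdot>\<^bsub>B\<^esub> w"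
    using a b by (simp_all add: Hom_def)
  ultimately have "\<exists>!c. c \<in> Hom E (Dom E b) (Dom E a) \<and> amap p c = w \<and> a \<cdot>\<^bsub>E\<^esub> c = b"
    using a(2) unfolding cartesian_arrow_def by blast
  then show "lifts_to W (reindex E B p u Y) w" using a(1) b(1) by (auto simp: lifts_to_def Hom_def)
qed

end

section \<open>Meets in the fibres\<close>

context posetal_fibration_with_meets
begin

text \<open>The infimum is a Hilbert choice among greatest lower bounds, and
  \<open>fibre_meet\<close> provides one to choose.\<close>

lemma fibre_inf_is_glb:
  assumes "I \<in> Obj B" "A \<subseteq> carrier (fibre E B p I)"
  shows "is_glb (fibre E B p I) (\<Sqinter>\<^bsub>fibre E B p I\<^esub> A) A"
  using fibre_meet[OF assms] unfolding inf_def by (rule someI_ex)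

text \<open>By itself a meet in the fibre over \<open>I\<close> controls only arrows over the
  identity. Reindexing along \<open>w\<close> carries the question to the fibre over
  \<open>omap p W\<close>, where \<open>W\<close> itself lies, and by \<open>reindex_meet\<close>
  the meet is still a meet there.\<close>

lemma lifts_to_glb_iff:
  assumes I: "I \<in> Obj B" and A: "A \<subseteq> carrier (fibre E B p I)"
    and M: "is_glb (fibre E B p I) M A"
    and W: "W \<in> Obj E" and w: "w \<in> Hom B (omap p W) I"
  shows "lifts_to W M w \<longleftrightarrow> (\<forall>Y \<in> A. lifts_to W Y w)"
proof
  assume WM: "lifts_to W M w"
  show "\<forall>Y \<in> A. lifts_to W Y w"
  proof
    fix Y assume Y: "Y \<in> A"
    have "M \<sqsubseteq>\<^bsub>fibre E B p I\<^esub> Y" using M Y A by (auto simp: greatest_def Lower_def)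
    then have "lifts_to W Y (Ident B I \<cdot>\<^bsub>B\<^esub> w)"
      using WM lifts_to_Comp fibre_le_iff by blast
    then show "lifts_to W Y w" using D.Ident_left[OF w] by simp
  qed
next
  assume WA: "\<forall>Y \<in> A. lifts_to W Y w"
  let ?J = "omap p W"
  have M': "M \<in> Obj E" "omap p M = I"
    using M by (auto simp: greatest_def Lower_def carrier_fibre_iff)
  have "is_glb (fibre E B p ?J) (reindex E B p w M) (reindex E B p w ` A)"
    by (rule reindex_meet[OF w A M])
  moreover have "W \<in> Lower (fibre E B p ?J) (reindex E B p w ` A)"
  proof -
    have "W \<sqsubseteq>\<^bsub>fibre E B p ?J\<^esub> reindex E B p w Y" if Y: "Y \<in> A" for Y
    proof -
      have Y': "Y \<in> Obj E" "omap p Y = I" using A Y by (auto simp: carrier_fibre_iff)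
      show ?thesis
        using WA Y Y' w D.Ident_in_Hom[OF omap_in_Obj[OF W]] D.Ident_right[OF w]
        by (simp add: fibre_le_iff lifts_to_reindex_iff)
    qed
    then show ?thesis using W by (auto simp: Lower_def carrier_fibre_iff)
  qed
  ultimately have "lifts_to W (reindex E B p w M) (Ident B ?J)"
    by (auto simp: greatest_def fibre_le_iff)
  \<comment> \<open>The Cartesian arrow over \<open>w\<close> leads back from the fibre of
    \<open>W\<close> to \<open>M\<close>.\<close>
  then have "lifts_to W M (w \<cdot>\<^bsub>B\<^esub> Ident B ?J)"
    using lifts_to_Comp reindex_lifts_to M' w by metis
  then show "lifts_to W M w" using D.Ident_right[OF w] by simp
qed

end

section \<open>Kleisli extension in a monad\<close>

context cat_monad
begin

lemma mobj_in_Obj: "X \<in> Obj C \<Longrightarrow> mobj T X \<in> Obj C"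
  by (rule unit.G.omap_in_Obj)

lemma marr_in_Hom: "f \<in> Hom C X Y \<Longrightarrow> marr T f \<in> Hom C (mobj T X) (mobj T Y)"
  by (rule unit.G.amap_in_Hom)

lemma munit_in_Hom: "X \<in> Obj C \<Longrightarrow> munit T X \<in> Hom C X (mobj T X)"
  using unit.component_in_Hom by (simp add: id_fctr_def)

lemma mmult_in_Hom: "X \<in> Obj C \<Longrightarrow> mmult T X \<in> Hom C (mobj T (mobj T X)) (mobj T X)"
  using mult.component_in_Hom by (simp add: comp_fctr_def)

lemma munit_naturality: "f \<in> Hom C X Y \<Longrightarrow> munit T Y \<cdot> f = marr T f \<cdot> munit T X"
  using unit.naturality by (simp add: id_fctr_def)

lemma mmult_naturality: "f \<in> Hom C X Y \<Longrightarrow> mmult T Y \<cdot> marr T (marr T f) = marr T f \<cdot> mmult T X"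
  using mult.naturality by (simp add: comp_fctr_def)

lemma kleisli_ext_in_Hom:
  "R \<in> Obj C \<Longrightarrow> f \<in> Hom C Y (mobj T R) \<Longrightarrow> kleisli_ext C T R f \<in> Hom C (mobj T Y) (mobj T R)"
  unfolding kleisli_ext_def
  by (rule unit.F.C.Comp_in_Hom[OF marr_in_Hom mmult_in_Hom])

lemma kleisli_ext_munit:
  "R \<in> Obj C \<Longrightarrow> kleisli_ext C T R (munit T R) = Ident C (mobj T R)"
  unfolding kleisli_ext_def by (rule mult_unit_right)

text \<open>Naturality of \<eta> moves \<open>f\<close> to the right of the unit; the left unit law
  then cancels \<mu> against \<eta>.\<close>

lemma kleisli_ext_Comp_munit:
  assumes R: "R \<in> Obj C" and f: "f \<in> Hom C Y (mobj T R)"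
  shows "kleisli_ext C T R f \<cdot> munit T Y = f"
proof -
  have "kleisli_ext C T R f \<cdot> munit T Y = mmult T R \<cdot> (marr T f \<cdot> munit T Y)"
    unfolding kleisli_ext_def
    using unit.F.C.Comp_assoc munit_in_Hom marr_in_Hom[OF f] mmult_in_Hom[OF R]
      unit.F.C.Hom_in_Obj[OF f] by blast
  also have "\<dots> = mmult T R \<cdot> (munit T (mobj T R) \<cdot> f)"
    using munit_naturality[OF f] by simp
  also have "\<dots> = (mmult T R \<cdot> munit T (mobj T R)) \<cdot> f"
    using unit.F.C.Comp_assoc[OF f munit_in_Hom mmult_in_Hom] mobj_in_Obj[OF R] R by simp
  also have "\<dots> = f"
    using mult_unit_left[OF R] unit.F.C.Ident_left[OF f] by simp
  finally show ?thesis .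
qed

lemma kleisli_ext_Comp_marr:
  assumes R: "R \<in> Obj C" and f: "f \<in> Hom C Z (mobj T R)" and g: "g \<in> Hom C Y Z"
  shows "kleisli_ext C T R f \<cdot> marr T g = kleisli_ext C T R (f \<cdot> g)"
  unfolding kleisli_ext_def
  using unit.F.C.Comp_assoc[OF marr_in_Hom[OF g] marr_in_Hom[OF f] mmult_in_Hom[OF R]]
    unit.G.amap_Comp[OF g f] by simp

text \<open>Naturality of \<mu> brings the two multiplications together, associativity replaces the
  second by \<open>marr T (mmult T R)\<close>, and functoriality absorbs this into the outer
  extension.\<close>

lemma kleisli_ext_Comp_mmult:
  assumes R: "R \<in> Obj C" and f: "f \<in> Hom C Y (mobj T R)"
  shows "kleisli_ext C T R f \<cdot> mmult T Y = kleisli_ext C T R (kleisli_ext C T R f)"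
proof -
  have Y: "Y \<in> Obj C" using unit.F.C.Hom_in_Obj[OF f] by simp
  note Tf = marr_in_Hom[OF f] and TTf = marr_in_Hom[OF marr_in_Hom[OF f]] and m = mmult_in_Hom[OF R]
  have "kleisli_ext C T R f \<cdot> mmult T Y = mmult T R \<cdot> (marr T f \<cdot> mmult T Y)"
    unfolding kleisli_ext_def using unit.F.C.Comp_assoc[OF mmult_in_Hom[OF Y] Tf m] .
  also have "\<dots> = mmult T R \<cdot> (mmult T (mobj T R) \<cdot> marr T (marr T f))"
    using mmult_naturality[OF f] by simp
  also have "\<dots> = (mmult T R \<cdot> mmult T (mobj T R)) \<cdot> marr T (marr T f)"
    using unit.F.C.Comp_assoc[OF TTf mmult_in_Hom[OF mobj_in_Obj[OF R]] m] by simp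
  also have "\<dots> = kleisli_ext C T R (mmult T R) \<cdot> marr T (marr T f)"
    using mult_assoc[OF R] by (simp add: kleisli_ext_def)
  also have "\<dots> = kleisli_ext C T R (kleisli_ext C T R f)"
    using kleisli_ext_Comp_marr[OF R m Tf] by (simp add: kleisli_ext_def)
  finally show ?thesis .
qed

end

section \<open>Liftings generated by an object map\<close>

locale posetal_fibration_monad = posetal_fibration_with_meets E B p + T: cat_monad B T
  for E :: "('eo, 'ea) cat" and B :: "('bo, 'ba) cat" and p :: "('eo, 'ea, 'bo, 'ba) fctr"
    and T :: "('bo, 'ba) monad_data"
begin

text \<open>The two sides of each monad law in \<open>E\<close> are parallel arrows whose images
  under \<open>p\<close> agree by the same law for \<open>T\<close>, so \<open>arrow_eqI\<close>
  identifies them. The record is that of \<open>codensity\<close> with its object map left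
  arbitrary.\<close>

lemma lifting_of_object_map:
  assumes K_Obj: "\<And>Y. Y \<in> Obj E \<Longrightarrow> K Y \<in> Obj E"
    and K_over: "\<And>Y. Y \<in> Obj E \<Longrightarrow> omap p (K Y) = mobj T (omap p Y)"
    and K_arr: "\<And>f Y Z. f \<in> Hom E Y Z \<Longrightarrow> lifts_to (K Y) (K Z) (marr T (amap p f))"
    and K_unit: "\<And>Y. Y \<in> Obj E \<Longrightarrow> lifts_to Y (K Y) (munit T (omap p Y))"
    and K_mult: "\<And>Y. Y \<in> Obj E \<Longrightarrow> lifts_to (K (K Y)) (K Y) (mmult T (omap p Y))"
  shows "\<lparr>mfun = \<lparr>omap = K,
              amap = (\<lambda>f. arrow_over E p (K (Dom E f)) (K (Cod E f)) (marr T (amap p f)))\<rparr>,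
      munit = (\<lambda>Y. arrow_over E p Y (K Y) (munit T (omap p Y))),
      mmult = (\<lambda>Y. arrow_over E p (K (K Y)) (K Y) (mmult T (omap p Y)))\<rparr> \<in> Lift E B p T"
    (is "?K \<in> _")
proof -
  have arr: "marr ?K f \<in> Hom E (K Y) (K Z)" "amap p (marr ?K f) = marr T (amap p f)"
    if "f \<in> Hom E Y Z" for f Y Z
    using arrow_over[OF K_arr[OF that]] that by (auto simp: Hom_def)
  have unit: "munit ?K Y \<in> Hom E Y (K Y)" "amap p (munit ?K Y) = munit T (omap p Y)"
    if "Y \<in> Obj E" for Y
    using arrow_over[OF K_unit[OF that]] by auto
  have mult: "mmult ?K Y \<in> Hom E (K (K Y)) (K Y)" "amap p (mmult ?K Y) = mmult T (omap p Y)"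
    if "Y \<in> Obj E" for Y
    using arrow_over[OF K_mult[OF that]] by auto
  \<comment> \<open>Naming the record keeps the simplifier from unfolding its fields: the laws below
    need only \<open>MK\<close> and the ends and images given by \<open>arr\<close>,
    \<open>unit\<close> and \<open>mult\<close>.\<close>
  obtain M where M: "M = ?K" by blast
  have MK: "mobj M = K" using M by simp
  note arr = arr[folded M] and unit = unit[folded M] and mult = mult[folded M]
  have K_functor: "cat_functor E E (mfun M)"
  proof (unfold_locales, unfold MK)
    fix Y assume Y: "Y \<in> Obj E"
    show "K Y \<in> Obj E" by (rule K_Obj[OF Y])
    show "marr M (Ident E Y) = Ident E (K Y)"
    proof (rule arrow_eqI)
      show "amap p (marr M (Ident E Y)) = amap p (Ident E (K Y))"
        using arr[OF C.Ident_in_Hom[OF Y]] Y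
        by (simp add: amap_Ident K_Obj K_over T.unit.G.amap_Ident omap_in_Obj)
    qed (use Y in \<open>auto intro!: arr C.Ident_in_Hom K_Obj\<close>)
  next
    fix f Y Z assume "f \<in> Hom E Y Z"
    then show "marr M f \<in> Hom E (K Y) (K Z)" by (rule arr)
  next
    fix f g X Y Z assume f: "f \<in> Hom E X Y" and g: "g \<in> Hom E Y Z"
    show "marr M (g \<cdot>\<^bsub>E\<^esub> f) = marr M g \<cdot>\<^bsub>E\<^esub> marr M f"
    proof (rule arrow_eqI)
      show "marr M (g \<cdot>\<^bsub>E\<^esub> f) \<in> Hom E (K X) (K Z)" by (rule arr[OF C.Comp_in_Hom[OF f g]])
      show "marr M g \<cdot>\<^bsub>E\<^esub> marr M f \<in> Hom E (K X) (K Z)"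
        by (rule C.Comp_in_Hom[OF arr(1)[OF f] arr(1)[OF g]])
      show "amap p (marr M (g \<cdot>\<^bsub>E\<^esub> f)) = amap p (marr M g \<cdot>\<^bsub>E\<^esub> marr M f)"
        by (simp add: arr(2)[OF C.Comp_in_Hom[OF f g]] amap_Comp[OF arr(1)[OF f] arr(1)[OF g]]
            arr(2)[OF f] arr(2)[OF g] amap_Comp[OF f g]
            T.unit.G.amap_Comp[OF amap_in_Hom[OF f] amap_in_Hom[OF g]])
    qed
  qed
  interpret M: cat_functor E E "mfun M" by (rule K_functor)
  have "nat_trans E E id_fctr (mfun M) (munit M)"
  proof (unfold_locales, unfold MK id_fctr_def fctr.simps)
    fix f Y Z assume f: "f \<in> Hom E Y Z"
    note YZ = C.Hom_in_Obj[OF f]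
    note l = f unit(1)[OF YZ(2)] and r = unit(1)[OF YZ(1)] arr(1)[OF f]
    show "munit M Z \<cdot>\<^bsub>E\<^esub> f = marr M f \<cdot>\<^bsub>E\<^esub> munit M Y"
      by (rule arrow_eqI[OF C.Comp_in_Hom[OF l] C.Comp_in_Hom[OF r]])
        (simp add: amap_Comp[OF l] amap_Comp[OF r] unit(2) YZ arr(2)[OF f]
          T.munit_naturality[OF amap_in_Hom[OF f]])
  qed (auto intro: unit C.Ident_in_Hom C.Comp_in_Hom)
  moreover have "nat_trans E E (comp_fctr (mfun M) (mfun M)) (mfun M) (mmult M)"
  proof (unfold_locales, unfold MK comp_fctr_def fctr.simps o_apply)
    fix f Y Z assume f: "f \<in> Hom E Y Z"
    note YZ = C.Hom_in_Obj[OF f]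
    note l = arr(1)[OF arr(1)[OF f]] mult(1)[OF YZ(2)] and r = mult(1)[OF YZ(1)] arr(1)[OF f]
    show "mmult M Z \<cdot>\<^bsub>E\<^esub> marr M (marr M f) = marr M f \<cdot>\<^bsub>E\<^esub> mmult M Y"
      by (rule arrow_eqI[OF C.Comp_in_Hom[OF l] C.Comp_in_Hom[OF r]])
        (simp add: amap_Comp[OF l] amap_Comp[OF r] mult(2) YZ arr(2)[OF arr(1)[OF f]] arr(2)[OF f]
          T.mmult_naturality[OF amap_in_Hom[OF f]])
  next
    \<comment> \<open>Functoriality of the composite of \<open>mfun M\<close> with itself, an
      obligation because it is the source of the multiplication.\<close>
    fix f g X Y Z assume f: "f \<in> Hom E X Y" and g: "g \<in> Hom E Y Z"
    show "marr M (marr M (g \<cdot>\<^bsub>E\<^esub> f)) = marr M (marr M g) \<cdot>\<^bsub>E\<^esub> marr M (marr M f)"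
      using M.amap_Comp[OF f g] M.amap_Comp[OF arr(1)[OF f] arr(1)[OF g]] by simp
  qed (auto intro: mult arr simp: K_Obj M.amap_Ident[unfolded MK])
  ultimately have "cat_monad E M"
  proof (intro cat_monad.intro cat_monad_axioms.intro, unfold MK)
    fix Y assume Y: "Y \<in> Obj E"
    note KY = K_Obj[OF Y] and KKY = K_Obj[OF K_Obj[OF Y]]
    note pY = omap_in_Obj[OF Y]
    note id = C.Ident_in_Hom[OF KY]
    note l = unit(1)[OF KY] mult(1)[OF Y]
    show "mmult M Y \<cdot>\<^bsub>E\<^esub> munit M (K Y) = Ident E (K Y)"
      by (rule arrow_eqI[OF C.Comp_in_Hom[OF l] id])
        (simp add: amap_Comp[OF l] amap_Ident KY unit(2) mult(2) Y K_over T.mult_unit_left[OF pY])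
    note r = arr(1)[OF unit(1)[OF Y]] mult(1)[OF Y]
    show "mmult M Y \<cdot>\<^bsub>E\<^esub> marr M (munit M Y) = Ident E (K Y)"
      by (rule arrow_eqI[OF C.Comp_in_Hom[OF r] id])
        (simp add: amap_Comp[OF r] amap_Ident KY arr(2)[OF unit(1)[OF Y]] unit(2) mult(2) Y K_over
          T.mult_unit_right[OF pY])
    note a = mult(1)[OF KY] mult(1)[OF Y] and b = arr(1)[OF mult(1)[OF Y]] mult(1)[OF Y]
    show "mmult M Y \<cdot>\<^bsub>E\<^esub> mmult M (K Y) = mmult M Y \<cdot>\<^bsub>E\<^esub> marr M (mmult M Y)"
      by (rule arrow_eqI[OF C.Comp_in_Hom[OF a] C.Comp_in_Hom[OF b]])
        (simp add: amap_Comp[OF a] amap_Comp[OF b] KY arr(2)[OF mult(1)[OF Y]] mult(2) Y K_over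
          T.mult_assoc[OF pY])
  qed
  moreover have "amap p (marr M f) = marr T (amap p f)" if "f \<in> Arr E" for f
    by (rule arr(2)[of f "Dom E f" "Cod E f"]) (use that in \<open>simp add: Hom_def\<close>)
  ultimately have "M \<in> Lift E B p T"
    unfolding Lift_def by (simp add: MK K_over unit(2) mult(2))
  then show ?thesis using M by simp
qed

section \<open>The codensity lifting\<close>

text \<open>The universal property of the meet, followed by that of each reindexing along
  \<open>f\<^sup>#\<close>.\<close>

lemma codensity_obj_in_fibre_and_lifts_to_iff:
  assumes R: "R \<in> Obj B" and S: "S \<in> carrier (fibre E B p (mobj T R))" and Y: "Y \<in> Obj E"
  shows codensity_obj_in_fibre:
      "codensity_obj E B p T R S Y \<in> carrier (fibre E B p (mobj T (omap p Y)))"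
    and lifts_to_codensity_obj_iff:
      "W \<in> Obj E \<Longrightarrow> w \<in> Hom B (omap p W) (mobj T (omap p Y)) \<Longrightarrow>
       lifts_to W (codensity_obj E B p T R S Y) w \<longleftrightarrow>
       (\<forall>f \<in> Hom E Y S. lifts_to W S (kleisli_ext B T R (amap p f) \<cdot>\<^bsub>B\<^esub> w))"
proof -
  let ?I = "mobj T (omap p Y)"
  let ?A = "(\<lambda>f. reindex E B p (kleisli_ext B T R (amap p f)) S) ` Hom E Y S"
  have S': "S \<in> Obj E" "omap p S = mobj T R" using S by (auto simp: carrier_fibre_iff)
  have ext: "kleisli_ext B T R (amap p f) \<in> Hom B ?I (omap p S)" if "f \<in> Hom E Y S" for f
    using T.kleisli_ext_in_Hom[OF R] amap_in_Hom[OF that] S'(2) by simp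
  have A: "?A \<subseteq> carrier (fibre E B p ?I)" using reindex_in_fibre[OF S'(1) ext] by blast
  have I: "?I \<in> Obj B" by (rule T.mobj_in_Obj[OF omap_in_Obj[OF Y]])
  have glb: "is_glb (fibre E B p ?I) (codensity_obj E B p T R S Y) ?A"
    unfolding codensity_obj_def by (rule fibre_inf_is_glb[OF I A])
  then show "codensity_obj E B p T R S Y \<in> carrier (fibre E B p ?I)"
    by (auto simp: greatest_def Lower_def)
  show "lifts_to W (codensity_obj E B p T R S Y) w \<longleftrightarrow>
      (\<forall>f \<in> Hom E Y S. lifts_to W S (kleisli_ext B T R (amap p f) \<cdot>\<^bsub>B\<^esub> w))"
    if "W \<in> Obj E" "w \<in> Hom B (omap p W) ?I"
    using lifts_to_glb_iff[OF I A glb that] lifts_to_reindex_iff[OF S'(1) ext that(2)] by simp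
qed

text \<open>These are the projections of the meet, obtained by testing the universal property on the
  identity.\<close>

lemma codensity_obj_lifts_to:
  assumes R: "R \<in> Obj B" and S: "S \<in> carrier (fibre E B p (mobj T R))" and f: "f \<in> Hom E Y S"
  shows "lifts_to (codensity_obj E B p T R S Y) S (kleisli_ext B T R (amap p f))"
proof -
  let ?K = "codensity_obj E B p T R S Y"
  have Y: "Y \<in> Obj E" using C.Hom_in_Obj[OF f] by simp
  have K: "?K \<in> Obj E" "omap p ?K = mobj T (omap p Y)"
    using codensity_obj_in_fibre[OF R S Y] by (auto simp: carrier_fibre_iff)
  have "lifts_to ?K ?K (Ident B (omap p ?K))" by (rule lifts_to_Ident[OF K(1)])
  then have "lifts_to ?K S (kleisli_ext B T R (amap p f) \<cdot>\<^bsub>B\<^esub> Ident B (omap p ?K))"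
    using lifts_to_codensity_obj_iff[OF R S Y K(1)] lifts_to_in_Hom f K(2) by fastforce
  moreover have "kleisli_ext B T R (amap p f) \<in> Hom B (omap p ?K) (mobj T R)"
    using T.kleisli_ext_in_Hom[OF R] amap_in_Hom[OF f] S K(2) by (simp add: carrier_fibre_iff)
  ultimately show ?thesis using D.Ident_right by simp
qed

lemma codensity_in_Lift:
  assumes R: "R \<in> Obj B" and S: "S \<in> carrier (fibre E B p (mobj T R))"
  shows "codensity E B p T R S \<in> Lift E B p T"
  unfolding codensity_def Let_def
proof (rule lifting_of_object_map)
  let ?K = "codensity_obj E B p T R S"
  have pS: "omap p S = mobj T R" using S by (simp add: carrier_fibre_iff)
  show K: "?K Y \<in> Obj E" "omap p (?K Y) = mobj T (omap p Y)" if "Y \<in> Obj E" for Y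
    using codensity_obj_in_fibre[OF R S that] by (auto simp: carrier_fibre_iff)
  have pf: "amap p f \<in> Hom B (omap p Y) (mobj T R)" if "f \<in> Hom E Y S" for f Y
    using amap_in_Hom[OF that] pS by simp
  show "lifts_to (?K Y) (?K Z) (marr T (amap p g))" if g: "g \<in> Hom E Y Z" for g Y Z
  proof -
    note YZ = C.Hom_in_Obj[OF g]
    \<comment> \<open>A test arrow \<open>f\<close> on \<open>Z\<close> yields the test arrow
      \<open>f \<cdot> g\<close> on \<open>Y\<close>, whose projection lies over the required
      composite.\<close>
    have "lifts_to (?K Y) S (kleisli_ext B T R (amap p f) \<cdot>\<^bsub>B\<^esub> marr T (amap p g))"
      if f: "f \<in> Hom E Z S" for f
      using codensity_obj_lifts_to[OF R S C.Comp_in_Hom[OF g f]]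
        T.kleisli_ext_Comp_marr[OF R pf[OF f] amap_in_Hom[OF g]] amap_Comp[OF g f] by simp
    moreover have "marr T (amap p g) \<in> Hom B (omap p (?K Y)) (mobj T (omap p Z))"
      using T.marr_in_Hom[OF amap_in_Hom[OF g]] K(2)[OF YZ(1)] by simp
    ultimately show ?thesis
      using lifts_to_codensity_obj_iff[OF R S YZ(2) K(1)[OF YZ(1)]] by simp
  qed
  show "lifts_to Y (?K Y) (munit T (omap p Y))" if Y: "Y \<in> Obj E" for Y
  proof -
    \<comment> \<open>The composite is the image of \<open>f\<close>, so \<open>f\<close> itself is
      the lift.\<close>
    have "lifts_to Y S (kleisli_ext B T R (amap p f) \<cdot>\<^bsub>B\<^esub> munit T (omap p Y))"
      if f: "f \<in> Hom E Y S" for f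
      using lifts_toI[OF f refl] T.kleisli_ext_Comp_munit[OF R pf[OF f]] by simp
    then show ?thesis
      using lifts_to_codensity_obj_iff[OF R S Y Y T.munit_in_Hom[OF omap_in_Obj[OF Y]]] by simp
  qed
  show "lifts_to (?K (?K Y)) (?K Y) (mmult T (omap p Y))" if Y: "Y \<in> Obj E" for Y
  proof -
    have "lifts_to (?K (?K Y)) S (kleisli_ext B T R (amap p f) \<cdot>\<^bsub>B\<^esub> mmult T (omap p Y))"
      if f: "f \<in> Hom E Y S" for f
    proof -
      \<comment> \<open>The projection at \<open>f\<close> is an arrow from \<open>?K Y\<close> to
        \<open>S\<close>, hence itself a test arrow for the outer \<open>?K\<close>; its own
        projection lies over the extension of \<open>f\<^sup>#\<close>.\<close>
      obtain h where h: "h \<in> Hom E (?K Y) S" "amap p h = kleisli_ext B T R (amap p f)"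
        using codensity_obj_lifts_to[OF R S f] by (auto simp: lifts_to_def)
      show ?thesis
        using codensity_obj_lifts_to[OF R S h(1)] h(2) T.kleisli_ext_Comp_mmult[OF R pf[OF f]]
        by simp
    qed
    moreover have "mmult T (omap p Y) \<in> Hom B (omap p (?K (?K Y))) (mobj T (omap p Y))"
      using T.mmult_in_Hom[OF omap_in_Obj[OF Y]] K(2)[OF Y] K(2)[OF K(1)[OF Y]] by simp
    ultimately show ?thesis
      using lifts_to_codensity_obj_iff[OF R S Y K(1)[OF K(1)[OF Y]]] by simp
  qed
qed

lemma mobj_codensity: "mobj (codensity E B p T R S) = codensity_obj E B p T R S"
  by (simp add: codensity_def Let_def)

section \<open>Comparison of a lifting with its codensity lifting\<close>

lemma Lift_mobj_in_fibre:
  assumes "T' \<in> Lift E B p T" "X \<in> Obj E"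
  shows "mobj T' X \<in> carrier (fibre E B p (mobj T (omap p X)))"
  using assms cat_monad.mobj_in_Obj[of E T' X] by (simp add: Lift_def carrier_fibre_iff)

lemma Lift_le_codensity:
  assumes T': "T' \<in> Lift E B p T" and X: "X \<in> Obj E"
  shows "lift_le E B p T T' (codensity E B p T (omap p X) (mobj T' X))"
  unfolding lift_le_def
proof
  fix Y assume Y: "Y \<in> Obj E"
  interpret M: cat_monad E T' using T' by (simp add: Lift_def)
  let ?S = "mobj T' X"
  note R = omap_in_Obj[OF X] and S = Lift_mobj_in_fibre[OF T' X]
  have TY: "mobj T' Y \<in> Obj E" "omap p (mobj T' Y) = mobj T (omap p Y)"
    using Lift_mobj_in_fibre[OF T' Y] by (auto simp: carrier_fibre_iff)
  have pY: "mobj T (omap p Y) \<in> Obj B" by (rule T.mobj_in_Obj[OF omap_in_Obj[OF Y]])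
  have "lifts_to (mobj T' Y) ?S
      (kleisli_ext B T (omap p X) (amap p f) \<cdot>\<^bsub>B\<^esub> Ident B (mobj T (omap p Y)))"
    if f: "f \<in> Hom E Y ?S" for f
  proof (rule lifts_toI)
    \<comment> \<open>The witness is the Kleisli extension taken in \<open>E\<close> for
      \<open>T'\<close>; it lies over the one for \<open>T\<close> since \<open>p\<close> preserves
      composites and \<open>T'\<close> lifts \<open>T\<close>.\<close>
    show "kleisli_ext E T' X f \<in> Hom E (mobj T' Y) ?S" by (rule M.kleisli_ext_in_Hom[OF X f])
    have "amap p (kleisli_ext E T' X f) = kleisli_ext B T (omap p X) (amap p f)"
      using T' X f amap_Comp[OF M.marr_in_Hom[OF f] M.mmult_in_Hom[OF X]]
      by (simp add: kleisli_ext_def Lift_def Hom_def)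
    moreover have "amap p f \<in> Hom B (omap p Y) (mobj T (omap p X))"
      using amap_in_Hom[OF f] S by (simp add: carrier_fibre_iff)
    ultimately show "amap p (kleisli_ext E T' X f) =
        kleisli_ext B T (omap p X) (amap p f) \<cdot>\<^bsub>B\<^esub> Ident B (mobj T (omap p Y))"
      using D.Ident_right[OF T.kleisli_ext_in_Hom[OF R]] by simp
  qed
  then show "mobj T' Y \<sqsubseteq>\<^bsub>fibre E B p (mobj T (omap p Y))\<^esub>
      mobj (codensity E B p T (omap p X) ?S) Y"
    using lifts_to_codensity_obj_iff[OF R S Y TY(1)] TY(2) D.Ident_in_Hom[OF pY]
    by (simp add: mobj_codensity fibre_le_iff)
qed

text \<open>Makes \<open>q_map X\<close> land in \<open>Cls\<close>. The inequality of
  \<open>Lift_le_codensity\<close> at \<open>X\<close> is reversed by a vertical projection, and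
  antisymmetry gives the fixed point.\<close>

lemma Lift_mobj_in_Cls:
  assumes T': "T' \<in> Lift E B p T" and X: "X \<in> Obj E"
  shows "mobj T' X \<in> Cls E B p T X"
proof -
  interpret M: cat_monad E T' using T' by (simp add: Lift_def)
  let ?S = "mobj T' X" and ?I = "mobj T (omap p X)"
  note R = omap_in_Obj[OF X] and S = Lift_mobj_in_fibre[OF T' X]
  interpret po: partial_order "fibre E B p ?I"
    by (rule fibre_partial_order[OF T.mobj_in_Obj[OF R]])
  \<comment> \<open>The unit of \<open>T'\<close> at \<open>X\<close> is a test arrow into
    \<open>?S\<close> lying over the unit of \<open>T\<close>, whose extension is the
    identity.\<close>
  have "lifts_to (codensity_obj E B p T (omap p X) ?S X) ?S (Ident B ?I)"
    using codensity_obj_lifts_to[OF R S M.munit_in_Hom[OF X]] T' X T.kleisli_ext_munit[OF R]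
    by (simp add: Lift_def)
  moreover have "?S \<sqsubseteq>\<^bsub>fibre E B p ?I\<^esub> codensity_obj E B p T (omap p X) ?S X"
    using Lift_le_codensity[OF T' X] X by (simp add: lift_le_def mobj_codensity)
  ultimately have "?S = codensity_obj E B p T (omap p X) ?S X"
    using po.le_antisym S codensity_obj_in_fibre[OF R S X] by (simp add: fibre_le_iff)
  then show ?thesis using S by (simp add: Cls_def mobj_codensity)
qed

end

theorem theorem8p5:
  fixes E :: "('eo, 'ea) cat" and B :: "('bo, 'ba) cat"
    and p :: "('eo, 'ea, 'bo, 'ba) fctr"
    and T :: "('bo, 'ba) monad_data"
    and X :: 'eo
  assumes "posetal_fibration_with_meets E B p"
    and "cat_monad B T"
    and "X \<in> Obj E"
  shows "codensity E B p T (omap p X) \<in> Cls E B p T X \<rightarrow> Lift E B p T \<and>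
    q_map X \<in> Lift E B p T \<rightarrow> Cls E B p T X \<and>
    (\<forall>S \<in> Cls E B p T X. (q_map X \<circ> codensity E B p T (omap p X)) S = S) \<and>
    (\<forall>T' \<in> Lift E B p T. lift_le E B p T T' ((codensity E B p T (omap p X) \<circ> q_map X) T'))"
proof -
  interpret posetal_fibration_monad E B p T
    using assms(1,2) by (rule posetal_fibration_monad.intro)
  show ?thesis
    \<comment> \<open>That \<open>q_map X\<close> undoes the codensity lifting on \<open>Cls\<close>
      is the fixed-point equation in \<open>Cls_def\<close>.\<close>
    using codensity_in_Lift omap_in_Obj Lift_mobj_in_Cls Lift_le_codensity assms(3)
    by (auto simp: q_map_def Cls_def)
qed

end
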